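(* Let $M$ be an ordered $\Gamma$-groupoid and let $\mu,\sigma$ be fuzzy semiprime ideals of $M$. Then $\mu\times\sigma$ is a fuzzy semiprime ideal of $M\times M$.
   Context: Let $M,\Gamma$ be nonempty sets. $M$ is a $\Gamma$-groupoid if there is a well-defined operation $M\times\Gamma\times M\to M$, $(a,\gamma,b)\mapsto a\gamma b$ (no associativity assumed). An ordered $\Gamma$-groupoid is a $\Gamma$-groupoid $M$ with a partial order $\le$ on $M$ such that $a\le b$ implies $a\gamma c\le b\gamma c$ and $c\gamma a\le c\gamma b$ for all $c\in M$, $\gamma\in\Gamma$. $M\times M$ is an ordered $\Gamma$-groupoid under $(a,b)\gamma(c,d):=(a\gamma c,b\gamma d)$ and the componentwise order: $(a,b)\le(c,d)$ iff $a\le c$ and $b\le d$. A fuzzy subset of an ordered $\Gamma$-groupoid $N$ is any mapping $\mu:N\to[0,1]$. It is a fuzzy left (resp. right) ideal of $N$ if (1) $\mu(x\gamma y)\ge\mu(y)$ (resp. $\mu(x\gamma y)\ge\mu(x)$) for all $x,y\in N$, $\gamma\in\Gamma$, and (2) $x\le y$ implies $\mu(x)\ge\mu(y)$. It is a fuzzy ideal if it is both a fuzzy left and a fuzzy right ideal. It is a fuzzy semiprime subset if $\mu(x)\ge\mu(x\gamma x)$ for all $x\in N$, $\gamma\in\Gamma$. A fuzzy semiprime ideal is a fuzzy ideal which is a fuzzy semiprime subset. For fuzzy subsets $\mu,\sigma$ of $M$, $\mu\times\sigma$ is the fuzzy subset of $M\times M$ given by $(\mu\times\sigma)(x,y):=\min\{\mu(x),\sigma(y)\}$.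 *)

theory Defs
  imports Complex_Main
begin

text \<open>
  \<open>M\<close> and \<open>\<Gamma>\<close> are carrier sets; \<open>f a \<gamma> b\<close> stands for the product \<open>a \<gamma> b\<close>, and the order is the
  relation \<open>r\<close> on \<open>M\<close>. Operations and fuzzy subsets are total functions in HOL whose values off
  the carriers are unconstrained and irrelevant.
\<close>

locale gamma_groupoid =
  fixes M :: "'a set" and \<Gamma> :: "'g set" and f :: "'a \<Rightarrow> 'g \<Rightarrow> 'a \<Rightarrow> 'a"
  assumes M_nonempty: "M \<noteq> {}"
    and Gamma_nonempty: "\<Gamma> \<noteq> {}"
    and closed: "\<lbrakk>a \<in> M; \<gamma> \<in> \<Gamma>; b \<in> M\<rbrakk> \<Longrightarrow> f a \<gamma> b \<in> M"

locale ordered_gamma_groupoid = gamma_groupoid M \<Gamma> f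
  for M :: "'a set" and \<Gamma> :: "'g set" and f :: "'a \<Rightarrow> 'g \<Rightarrow> 'a \<Rightarrow> 'a" +
  fixes r :: "'a rel"
  assumes partial_order: "partial_order_on M r"
    and mult_right_mono: "\<lbrakk>(a, b) \<in> r; c \<in> M; \<gamma> \<in> \<Gamma>\<rbrakk> \<Longrightarrow> (f a \<gamma> c, f b \<gamma> c) \<in> r"
    and mult_left_mono: "\<lbrakk>(a, b) \<in> r; c \<in> M; \<gamma> \<in> \<Gamma>\<rbrakk> \<Longrightarrow> (f c \<gamma> a, f c \<gamma> b) \<in> r"

definition prod_op :: "('a \<Rightarrow> 'g \<Rightarrow> 'a \<Rightarrow> 'a) \<Rightarrow> 'a \<times> 'a \<Rightarrow> 'g \<Rightarrow> 'a \<times> 'a \<Rightarrow> 'a \<times> 'a" where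
  "prod_op f p \<gamma> q = (f (fst p) \<gamma> (fst q), f (snd p) \<gamma> (snd q))"

definition prod_order :: "'a rel \<Rightarrow> ('a \<times> 'a) rel" where
  "prod_order r = {((a, b), (c, d)). (a, c) \<in> r \<and> (b, d) \<in> r}"

definition fuzzy_subset :: "'a set \<Rightarrow> ('a \<Rightarrow> real) \<Rightarrow> bool" where
  "fuzzy_subset N \<mu> \<longleftrightarrow> (\<forall>x\<in>N. \<mu> x \<in> {0..1})"

definition fuzzy_left_ideal ::
    "'a set \<Rightarrow> 'g set \<Rightarrow> ('a \<Rightarrow> 'g \<Rightarrow> 'a \<Rightarrow> 'a) \<Rightarrow> 'a rel \<Rightarrow> ('a \<Rightarrow> real) \<Rightarrow> bool" where
  "fuzzy_left_ideal N \<Gamma> f r \<mu> \<longleftrightarrow>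
     fuzzy_subset N \<mu> \<and>
     (\<forall>x\<in>N. \<forall>y\<in>N. \<forall>\<gamma>\<in>\<Gamma>. \<mu> (f x \<gamma> y) \<ge> \<mu> y) \<and>
     (\<forall>x\<in>N. \<forall>y\<in>N. (x, y) \<in> r \<longrightarrow> \<mu> x \<ge> \<mu> y)"

definition fuzzy_right_ideal ::
    "'a set \<Rightarrow> 'g set \<Rightarrow> ('a \<Rightarrow> 'g \<Rightarrow> 'a \<Rightarrow> 'a) \<Rightarrow> 'a rel \<Rightarrow> ('a \<Rightarrow> real) \<Rightarrow> bool" where
  "fuzzy_right_ideal N \<Gamma> f r \<mu> \<longleftrightarrow>
     fuzzy_subset N \<mu> \<and>
     (\<forall>x\<in>N. \<forall>y\<in>N. \<forall>\<gamma>\<in>\<Gamma>. \<mu> (f x \<gamma> y) \<ge> \<mu> x) \<and>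
     (\<forall>x\<in>N. \<forall>y\<in>N. (x, y) \<in> r \<longrightarrow> \<mu> x \<ge> \<mu> y)"

definition fuzzy_ideal ::
    "'a set \<Rightarrow> 'g set \<Rightarrow> ('a \<Rightarrow> 'g \<Rightarrow> 'a \<Rightarrow> 'a) \<Rightarrow> 'a rel \<Rightarrow> ('a \<Rightarrow> real) \<Rightarrow> bool" where
  "fuzzy_ideal N \<Gamma> f r \<mu> \<longleftrightarrow> fuzzy_left_ideal N \<Gamma> f r \<mu> \<and> fuzzy_right_ideal N \<Gamma> f r \<mu>"

definition fuzzy_semiprime ::
    "'a set \<Rightarrow> 'g set \<Rightarrow> ('a \<Rightarrow> 'g \<Rightarrow> 'a \<Rightarrow> 'a) \<Rightarrow> ('a \<Rightarrow> real) \<Rightarrow> bool" where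
  "fuzzy_semiprime N \<Gamma> f \<mu> \<longleftrightarrow>
     fuzzy_subset N \<mu> \<and> (\<forall>x\<in>N. \<forall>\<gamma>\<in>\<Gamma>. \<mu> x \<ge> \<mu> (f x \<gamma> x))"

definition fuzzy_semiprime_ideal ::
    "'a set \<Rightarrow> 'g set \<Rightarrow> ('a \<Rightarrow> 'g \<Rightarrow> 'a \<Rightarrow> 'a) \<Rightarrow> 'a rel \<Rightarrow> ('a \<Rightarrow> real) \<Rightarrow> bool" where
  "fuzzy_semiprime_ideal N \<Gamma> f r \<mu> \<longleftrightarrow> fuzzy_ideal N \<Gamma> f r \<mu> \<and> fuzzy_semiprime N \<Gamma> f \<mu>"

definition fuzzy_prod :: "('a \<Rightarrow> real) \<Rightarrow> ('a \<Rightarrow> real) \<Rightarrow> 'a \<times> 'a \<Rightarrow> real" where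
  "fuzzy_prod \<mu> \<sigma> = (\<lambda>(x, y). min (\<mu> x) (\<sigma> y))"

lemma (in ordered_gamma_groupoid) ordered_gamma_groupoid_prod:
  "ordered_gamma_groupoid (M \<times> M) \<Gamma> (prod_op f) (prod_order r)"
proof
  have "r \<subseteq> M \<times> M" "refl_on M r" "trans r" "antisym r"
    using partial_order unfolding partial_order_on_def preorder_on_def by auto
  then show "partial_order_on (M \<times> M) (prod_order r)"
    unfolding partial_order_on_def preorder_on_def prod_order_def refl_on_def
    by (auto intro!: transI antisymI dest: transD antisymD)
qed (use M_nonempty Gamma_nonempty in
  \<open>auto simp: prod_op_def prod_order_def intro: closed mult_right_mono mult_left_mono\<close>)

end

theory Submission
  imports Defs
begin

text \<open>Product and order on \<open>M \<times> M\<close> are componentwise, so each defining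
  inequality for \<open>fuzzy_prod \<mu> \<sigma>\<close> compares two minima whose first arguments
  are related by the same inequality for \<open>\<mu>\<close> and second ones by that for
  \<open>\<sigma>\<close>. As \<open>min\<close> is monotone in both arguments
  (\<open>min.mono\<close>), the inequality passes to the minima.\<close>

theorem theorem16:
  fixes M :: "'a set" and \<Gamma> :: "'g set" and f :: "'a \<Rightarrow> 'g \<Rightarrow> 'a \<Rightarrow> 'a"
    and r :: "'a rel" and \<mu> \<sigma> :: "'a \<Rightarrow> real"
  assumes "ordered_gamma_groupoid M \<Gamma> f r"
    and "fuzzy_semiprime_ideal M \<Gamma> f r \<mu>"
    and "fuzzy_semiprime_ideal M \<Gamma> f r \<sigma>"
  shows "fuzzy_semiprime_ideal (M \<times> M) \<Gamma> (prod_op f) (prod_order r) (fuzzy_prod \<mu> \<sigma>)"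
proof -
  note defs = fuzzy_left_ideal_def fuzzy_right_ideal_def fuzzy_subset_def prod_op_def
    prod_order_def fuzzy_prod_def fuzzy_ideal_def fuzzy_semiprime_def fuzzy_semiprime_ideal_def
  have subset: "fuzzy_subset (M \<times> M) (fuzzy_prod \<mu> \<sigma>)"
    \<comment> \<open>A minimum is one of its two arguments, hence stays in
      \<open>{0..1}\<close>.\<close>
    using assms(2,3) by (auto simp: defs min_def)
  have left: "fuzzy_left_ideal (M \<times> M) \<Gamma> (prod_op f) (prod_order r) (fuzzy_prod \<mu> \<sigma>)"
    unfolding fuzzy_left_ideal_def using assms(2,3) subset
    \<comment> \<open>\<open>min.bounded_iff\<close> would split the upper \<open>min\<close> and
      lose the pairing of coordinates; without it \<open>min.mono\<close> leaves one inequality for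
      \<open>\<mu>\<close> and one for \<open>\<sigma>\<close>.\<close>
    by (auto simp: defs simp del: min.bounded_iff intro!: min.mono)
  have right: "fuzzy_right_ideal (M \<times> M) \<Gamma> (prod_op f) (prod_order r) (fuzzy_prod \<mu> \<sigma>)"
    unfolding fuzzy_right_ideal_def using assms(2,3) subset
    by (auto simp: defs simp del: min.bounded_iff intro!: min.mono)
  have "fuzzy_semiprime (M \<times> M) \<Gamma> (prod_op f) (fuzzy_prod \<mu> \<sigma>)"
    \<comment> \<open>The square of a pair is the pair of squares, so semiprimeness applies in each
      coordinate with the same \<open>\<gamma>\<close>.\<close>
    unfolding fuzzy_semiprime_def using assms(2,3) subset
    by (auto simp: defs simp del: min.bounded_iff intro!: min.mono)
  with left right show ?thesis
    by (simp add: fuzzy_semiprime_ideal_def fuzzy_ideal_def)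
qed

end
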